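(* For every finite tree $T$, its $2$-suppression $\overline T$ satisfies $$\mathrm{DN}_{\mathrm{LLY}}(\overline T)\le \mathrm{DN}_{\mathrm{LLY}}(T).$$
   Context: Graphs are simple and undirected. Let $d(\cdot,\cdot)$ be the combinatorial graph distance. For a positive edge weight $w:E\to(0,\infty)$ put $d_x^w:=\sum_{y\sim x}w_{xy}$. For $\alpha\in[0,1]$ let $\mu_x^{\alpha,w}$ be the probability measure with $\mu_x^{\alpha,w}(x)=\alpha$, $\mu_x^{\alpha,w}(z)=(1-\alpha)w_{xz}/d_x^w$ for $z\sim x$, and $0$ otherwise. Let $W_1$ be the $1$-Wasserstein distance with respect to $d$. For $x\sim y$ let $\kappa_\alpha^w(x,y):=1-W_1(\mu_x^{\alpha,w},\mu_y^{\alpha,w})$ and define the weighted Lin--Lu--Yau curvature $\kappa_{\mathrm{LLY}}^w(x,y):=\lim_{\alpha\to1^-}\kappa_\alpha^w(x,y)/(1-\alpha)$. For connected locally finite $G$ with $E\neq\varnothing$: $\mathrm{Dist}(w):=\sup_{e\in E}w_e/\inf_{e\in E}w_e$, with value $+\infty$ if the supremum is infinite or the infimum is $0$; a positive weight $w$ is admissible if $\kappa_{\mathrm{LLY}}^w(e)\ge0$ for every $e\in E$; and $\mathrm{DN}_{\mathrm{LLY}}(G):=\inf\{\mathrm{Dist}(w): w \text{ admissible}\}$, with value $+\infty$ if no admissible weight has finite distortion. By convention $\mathrm{DN}_{\mathrm{LLY}}(K_1)=1$. If $v$ is a vertex of degree $2$ of a finite tree with neighbors $x$ and $y$, suppressing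 $v$ means deleting $v$ and the edges $xv,vy$, and adding the edge $xy$. The $2$-suppression $\overline T$ of $T$ is obtained by repeatedly suppressing degree-two vertices until none remain. *)

theory Defs
  imports
    "HOL-Probability.Probability"
    "Graph_Theory.Pair_Digraph"
    "Graph_Theory.Digraph_Component"
    "Graph_Theory.Shortest_Path"
begin

text \<open>
  As in the AFP entry Graph\_Theory, a simple undirected graph is a loop-free pair digraph whose
  arc relation is symmetric: an edge $xy$ is represented by the two arcs $(x,y)$ and $(y,x)$.
\<close>

subsection \<open>Distance, weights and curvature\<close>

definition graph_dist :: "'a pair_pre_digraph \<Rightarrow> 'a \<Rightarrow> 'a \<Rightarrow> real" where
  "graph_dist G x y = real_of_ereal (wf_digraph.\<mu> (with_proj G) (\<lambda>_. 1) x y)"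

text \<open>
  A weight of the undirected edges assigns the same value to both arcs of an edge; its values
  outside the arc set are irrelevant.
\<close>

definition edge_weight :: "'a pair_pre_digraph \<Rightarrow> ('a \<times> 'a) weight_fun \<Rightarrow> bool" where
  "edge_weight G w \<longleftrightarrow>
     (\<forall>(x, y) \<in> parcs G. 0 < w (x, y) \<and> w (x, y) = w (y, x))"

definition wdegree :: "'a pair_pre_digraph \<Rightarrow> ('a \<times> 'a) weight_fun \<Rightarrow> 'a \<Rightarrow> real" where
  "wdegree G w x = (\<Sum>e \<in> out_arcs (with_proj G) x. w e)"

text \<open>
  The function below is a probability mass function whenever \<open>0 \<le> \<alpha> \<le> 1\<close>,
  \<open>w\<close> is a positive weight and \<open>x\<close> has a finite nonzero number of neighbours.
\<close>

definition walk_measure ::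
  "'a pair_pre_digraph \<Rightarrow> ('a \<times> 'a) weight_fun \<Rightarrow> real \<Rightarrow> 'a \<Rightarrow> 'a pmf" where
  "walk_measure G w \<alpha> x = embed_pmf (\<lambda>z.
     if z = x then \<alpha>
     else if (x, z) \<in> parcs G then (1 - \<alpha>) * w (x, z) / wdegree G w x
     else 0)"

text \<open>
  Infimum of the transport cost over all couplings. It is only applied to finitely supported
  measures, so every coupling is finitely supported and the cost is integrable.
\<close>

definition wasserstein1 :: "('a \<Rightarrow> 'a \<Rightarrow> real) \<Rightarrow> 'a pmf \<Rightarrow> 'a pmf \<Rightarrow> real" where
  "wasserstein1 d p q =
     Inf {measure_pmf.expectation c (\<lambda>(x, y). d x y) | c. map_pmf fst c = p \<and> map_pmf snd c = q}"

definition curvature ::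
  "'a pair_pre_digraph \<Rightarrow> ('a \<times> 'a) weight_fun \<Rightarrow> real \<Rightarrow> 'a \<Rightarrow> 'a \<Rightarrow> real" where
  "curvature G w \<alpha> x y =
     1 - wasserstein1 (graph_dist G) (walk_measure G w \<alpha> x) (walk_measure G w \<alpha> y)"

definition LLY_curvature ::
  "'a pair_pre_digraph \<Rightarrow> ('a \<times> 'a) weight_fun \<Rightarrow> 'a \<Rightarrow> 'a \<Rightarrow> real" where
  "LLY_curvature G w x y = Lim (at_left 1) (\<lambda>\<alpha>. curvature G w \<alpha> x y / (1 - \<alpha>))"


subsection \<open>Distortion\<close>

definition distortion :: "'a pair_pre_digraph \<Rightarrow> ('a \<times> 'a) weight_fun \<Rightarrow> ereal" where
  "distortion G w =
     (let M = (SUP e \<in> parcs G. ereal (w e)); m = (INF e \<in> parcs G. ereal (w e))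
      in if M = \<infinity> \<or> m = 0 then \<infinity> else M / m)"

definition admissible :: "'a pair_pre_digraph \<Rightarrow> ('a \<times> 'a) weight_fun \<Rightarrow> bool" where
  "admissible G w \<longleftrightarrow> edge_weight G w \<and> (\<forall>(x, y) \<in> parcs G. 0 \<le> LLY_curvature G w x y)"

text \<open>
  Meant for connected locally finite simple graphs, which are edgeless only if they have a single
  vertex. The infimum in \<^typ>\<open>ereal\<close> is \<open>\<infinity>\<close> if no admissible weight has finite distortion.
\<close>

definition DN_LLY :: "'a pair_pre_digraph \<Rightarrow> ereal" where
  "DN_LLY G = (if card (pverts G) = 1 then 1 else (INF w \<in> {w. admissible G w}. distortion G w))"


subsection \<open>Trees and suppression of vertices of degree two\<close>

text \<open>
  The library's \<^const>\<open>forest\<close> is not usable here: in a symmetric digraph the closed walk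
  along \<open>(x, y)\<close> and \<open>(y, x)\<close> counts as a cycle. The cycles of the undirected graph are those of
  length at least 3.
\<close>

definition finite_tree :: "'a pair_pre_digraph \<Rightarrow> bool" where
  "finite_tree T \<longleftrightarrow>
     pair_graph T \<and> Digraph_Component.connected (with_proj T) \<and>
     \<not> (\<exists>p. pre_digraph.cycle (with_proj T) p \<and> 3 \<le> length p)"

definition suppress :: "'a pair_pre_digraph \<Rightarrow> 'a \<Rightarrow> 'a \<Rightarrow> 'a \<Rightarrow> 'a pair_pre_digraph" where
  "suppress T v x y =
     \<lparr> pverts = pverts T - {v},
       parcs = (parcs T - {(x, v), (v, x), (v, y), (y, v)}) \<union> {(x, y), (y, x)} \<rparr>"

definition suppress_step :: "'a pair_pre_digraph \<Rightarrow> 'a pair_pre_digraph \<Rightarrow> bool" where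
  "suppress_step T T' \<longleftrightarrow>
     (\<exists>v \<in> pverts T. \<exists>x y. out_degree (with_proj T) v = 2 \<and>
        x \<noteq> y \<and> (v, x) \<in> parcs T \<and> (v, y) \<in> parcs T \<and> T' = suppress T v x y)"

text \<open>
  \<open>S\<close> is a possible result of suppressing vertices of degree two, in any order, until none remain.
\<close>

definition is_two_suppression :: "'a pair_pre_digraph \<Rightarrow> 'a pair_pre_digraph \<Rightarrow> bool" where
  "is_two_suppression T S \<longleftrightarrow>
     suppress_step\<^sup>*\<^sup>* T S \<and> \<not> (\<exists>v \<in> pverts S. out_degree (with_proj S) v = 2)"

lemma ex_suppress_step:
  assumes "v \<in> pverts T" "out_degree (with_proj T) v = 2"
  shows "\<exists>T'. suppress_step T T'"
proof -
  have "card (out_arcs (with_proj T) v) = 2"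
    using assms(2) by (simp add: out_degree_def)
  then obtain e f where ef: "out_arcs (with_proj T) v = {e, f}" "e \<noteq> f"
    by (auto simp: card_2_iff)
  then have "e \<in> out_arcs (with_proj T) v" "f \<in> out_arcs (with_proj T) v"
    by auto
  then have ends: "fst e = v" "fst f = v" "e \<in> parcs T" "f \<in> parcs T"
    by (auto simp: out_arcs_def)
  have "snd e \<noteq> snd f"
    using ef(2) ends by (auto simp: prod_eq_iff)
  moreover have "(v, snd e) \<in> parcs T" "(v, snd f) \<in> parcs T"
    using ends by (metis prod.collapse)+
  ultimately show ?thesis
    using assms unfolding suppress_step_def by blast
qed

lemma ex_two_suppression:
  assumes "finite (pverts T)"
  shows "\<exists>S. is_two_suppression T S"
  using assms
proof (induction "card (pverts T)" arbitrary: T rule: less_induct)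
  case less
  show ?case
  proof (cases "\<exists>v \<in> pverts T. out_degree (with_proj T) v = 2")
    case True
    then obtain v where "v \<in> pverts T" "out_degree (with_proj T) v = 2"
      by auto
    then obtain T' where T': "suppress_step T T'"
      using ex_suppress_step by metis
    then have "\<exists>v \<in> pverts T. pverts T' = pverts T - {v}"
      unfolding suppress_step_def suppress_def by fastforce
    then obtain v where v: "v \<in> pverts T" "pverts T' = pverts T - {v}"
      by (rule bexE)
    have "card (pverts T') < card (pverts T)" "finite (pverts T')"
      unfolding v(2) using less.prems v(1) by (rule card_Diff1_less, use less.prems in simp)
    then have "\<exists>S. is_two_suppression T' S"
      by (rule less.hyps)
    then obtain S where "is_two_suppression T' S"
      by (rule exE)
    then have "is_two_suppression T S"
      unfolding is_two_suppression_def
      using T' by (intro conjI converse_rtranclp_into_rtranclp[of suppress_step T T' S]) simp_all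
    then show ?thesis
      by (rule exI)
  next
    case False
    then have "is_two_suppression T T"
      unfolding is_two_suppression_def by simp
    then show ?thesis
      by (rule exI)
  qed
qed

end

theory Submission
  imports Defs
begin

text \<open>
  On an edge $xy$ of a forest, Kantorovich duality with a potential that is monotone across the
  edge gives $\kappa(x,y) = 2 (w_{xy}/d_x + w_{xy}/d_y - 1)$, so a weight is admissible iff
  $w_{xy}/d_x + w_{xy}/d_y \ge 1$ on all edges.

  Let $v$ have the two neighbours $x$ and $y$, with $p = w_{vx} \le q = w_{vy}$. Admissibility at
  $vx$ gives $d_x \le 2p$, and this propagates away from $v$: the weights on the side of $x$ do not
  increase along paths leaving $v$, hence are at most $p$. Scaling that side by $q/p \ge 1$ and
  giving the new edge $xy$ the weight $q$ therefore stays between the old extreme weights.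
  Degrees on the side of $x$ are scaled by $q/p$ and all others are unchanged, so admissibility
  need only be checked on $xy$, where it reads $p/d_x + q/d_y \ge 1$ and follows by adding the
  conditions on $vx$ and $vy$.
\<close>

subsection \<open>Transport of finitely supported measures\<close>

lemma pmf_embed_pmf_finite:
  fixes f :: "'a \<Rightarrow> real"
  assumes "finite A" "\<And>x. 0 \<le> f x" "\<And>x. x \<notin> A \<Longrightarrow> f x = 0" "sum f A = 1"
  shows "pmf (embed_pmf f) x = f x"
proof (rule pmf_embed_pmf)
  have "(\<integral>\<^sup>+ x. ennreal (f x) \<partial>count_space UNIV) = (\<Sum>x\<in>A. ennreal (f x))"
    using assms by (intro nn_integral_count_space') auto
  also have "\<dots> = 1"
    using assms by (simp add: sum_ennreal)
  finally show "(\<integral>\<^sup>+ x. ennreal (f x) \<partial>count_space UNIV) = 1" .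
qed (fact assms)

text \<open>The remainder \<open>r\<close> is renormalised so that \<open>p\<close> becomes the
  mixture of the point mass at \<open>y\<close>, taken with probability \<open>b\<close>, and
  \<open>r\<close>, taken with probability \<open>1 - b\<close>.\<close>

lemma pmf_remove_mass:
  assumes "finite (set_pmf p)" "0 \<le> b" "b < 1" "b \<le> pmf p y"
  obtains r where "\<And>z. pmf r z = (pmf p z - b * indicator {y} z) / (1 - b)"
proof
  let ?f = "\<lambda>z. (pmf p z - b * indicator {y} z) / (1 - b)"
  have "pmf (embed_pmf ?f) z = ?f z" for z
  proof (rule pmf_embed_pmf_finite[where A = "insert y (set_pmf p)"])
    show "0 \<le> ?f x" for x
      using assms by (auto simp: indicator_def)
    show "?f x = 0" if "x \<notin> insert y (set_pmf p)" for x
      using that by (auto simp: set_pmf_iff)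
    have "(\<Sum>z\<in>insert y (set_pmf p). pmf p z) = 1"
      using assms(1) by (intro sum_pmf_eq_1) auto
    moreover have "(\<Sum>z\<in>insert y (set_pmf p). b * indicator {y} z) = b"
      using assms(1) by (simp add: sum_distrib_left[symmetric] indicator_def sum.If_cases)
    ultimately show "sum ?f (insert y (set_pmf p)) = 1"
      using assms(3) by (simp only: sum_divide_distrib[symmetric] sum_subtractf) simp
  qed (use assms(1) in simp)
  then show "\<And>z. pmf (embed_pmf ?f) z = ?f z" .
qed

text \<open>
  The mass of \<open>p\<close> at \<open>y\<close> stays where it is and the rest is coupled independently; every pair of
  points charged by this coupling is tight for the potential \<open>f\<close>.
\<close>

lemma wasserstein1_eq_potential:
  fixes f :: "'a \<Rightarrow> real"
  assumes fin: "finite (set_pmf p)" "finite (set_pmf q)"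
    and lower: "\<And>u v. u \<in> set_pmf p \<Longrightarrow> v \<in> set_pmf q \<Longrightarrow> f u - f v \<le> d u v"
    and tight: "\<And>u v. u \<in> set_pmf p \<Longrightarrow> v \<in> set_pmf q \<Longrightarrow> u \<noteq> y \<Longrightarrow> d u v \<le> f u - f v"
    and diag: "d y y = 0"
    and mass: "pmf p y \<le> pmf q y" "pmf p y < 1"
  shows "wasserstein1 d p q = measure_pmf.expectation p f - measure_pmf.expectation q f"
proof -
  let ?E = "measure_pmf.expectation"
  \<comment> \<open>The integral of \<open>f u - f v\<close> depends only on the marginals, so it
    has the same value for every coupling and bounds every transport cost from below.\<close>
  have cost: "?E p f - ?E q f = ?E c (\<lambda>(u, v). f u - f v)"
    and support: "set_pmf c \<subseteq> set_pmf p \<times> set_pmf q" "finite (set_pmf c)"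
    if "map_pmf fst c = p" "map_pmf snd c = q" for c
  proof -
    show sub: "set_pmf c \<subseteq> set_pmf p \<times> set_pmf q"
      using that by force
    then show finc: "finite (set_pmf c)"
      using fin by (meson finite_SigmaI finite_subset)
    have "?E p f = ?E c (\<lambda>e. f (fst e))" "?E q f = ?E c (\<lambda>e. f (snd e))"
      using that by (metis integral_map_pmf)+
    then show "?E p f - ?E q f = ?E c (\<lambda>(u, v). f u - f v)"
      using finc by (simp add: case_prod_unfold integrable_measure_pmf_finite)
  qed
  define b where "b = pmf p y"
  have b: "0 \<le> b" "b < 1" "b \<le> pmf p y" "b \<le> pmf q y"
    using mass by (auto simp: b_def)
  obtain r where r: "\<And>z. pmf r z = (pmf p z - b * indicator {y} z) / (1 - b)"
    using pmf_remove_mass[OF fin(1) b(1,2,3)] by blast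
  obtain s where s: "\<And>z. pmf s z = (pmf q z - b * indicator {y} z) / (1 - b)"
    using pmf_remove_mass[OF fin(2) b(1,2,4)] by blast
  define c where "c = bind_pmf (bernoulli_pmf b)
    (\<lambda>t. if t then return_pmf (y, y) else pair_pmf r s)"
  have "map_pmf fst c = bind_pmf (bernoulli_pmf b) (\<lambda>t. if t then return_pmf y else r)"
    "map_pmf snd c = bind_pmf (bernoulli_pmf b) (\<lambda>t. if t then return_pmf y else s)"
    unfolding c_def map_bind_pmf
    by (auto intro!: bind_pmf_cong simp: map_fst_pair_pmf map_snd_pair_pmf)
  moreover have "bind_pmf (bernoulli_pmf b) (\<lambda>t. if t then return_pmf y else r) = p"
    "bind_pmf (bernoulli_pmf b) (\<lambda>t. if t then return_pmf y else s) = q"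
    using b by (auto intro!: pmf_eqI simp: pmf_bind r s indicator_def)
  ultimately have c: "map_pmf fst c = p" "map_pmf snd c = q"
    by simp_all
  \<comment> \<open>Since \<open>b\<close> is the whole mass of \<open>p\<close> at
    \<open>y\<close>, the independent part never starts at \<open>y\<close>; this is why tightness
    is only required for \<open>u \<noteq> y\<close>.\<close>
  have "set_pmf r \<subseteq> set_pmf p - {y}"
    using b by (auto simp: set_pmf_iff r b_def indicator_def split: if_splits)
  moreover have "set_pmf s \<subseteq> set_pmf q"
    using b by (auto simp: set_pmf_iff s indicator_def split: if_splits)
  ultimately have "(u, v) = (y, y) \<or> u \<in> set_pmf p - {y} \<and> v \<in> set_pmf q"
    if "(u, v) \<in> set_pmf c" for u v
    using that unfolding c_def by (auto split: if_splits)
  then have sc: "d u v = f u - f v" if "(u, v) \<in> set_pmf c" for u v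
    using that diag lower tight by (fastforce intro: antisym)
  show ?thesis
    unfolding wasserstein1_def
  proof (rule cInf_eq_minimum)
    have "?E c (\<lambda>(u, v). d u v) = ?E c (\<lambda>(u, v). f u - f v)"
      by (intro integral_cong_AE) (auto simp: AE_measure_pmf_iff sc)
    then show "?E p f - ?E q f \<in> {?E c (\<lambda>(x, y). d x y) | c. map_pmf fst c = p \<and> map_pmf snd c = q}"
      using c cost[OF c] by (intro CollectI exI[of _ c]) simp
  next
    fix t
    assume "t \<in> {?E c (\<lambda>(x, y). d x y) | c. map_pmf fst c = p \<and> map_pmf snd c = q}"
    then obtain c where c: "t = ?E c (\<lambda>(x, y). d x y)" "map_pmf fst c = p" "map_pmf snd c = q"
      by auto
    have "?E c (\<lambda>(u, v). f u - f v) \<le> ?E c (\<lambda>(x, y). d x y)"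
      using support[OF c(2,3)] lower
      by (intro integral_mono_AE)
        (auto simp: AE_measure_pmf_iff intro!: integrable_measure_pmf_finite)
    then show "?E p f - ?E q f \<le> t"
      using cost[OF c(2,3)] c(1) by simp
  qed
qed


subsection \<open>Curvature on forests\<close>

context pair_wf_digraph
begin

lemma awalk_cost_one [simp]: "awalk_cost (\<lambda>_. 1) p = real (length p)"
  by (induct p) auto

lemma graph_dist_le:
  assumes "awalk u p v"
  shows "graph_dist G u v \<le> real (length p)"
proof -
  have "0 \<le> \<mu> (\<lambda>_. 1) u v"
    unfolding \<mu>_def by (rule INF_greatest) auto
  moreover have "\<mu> (\<lambda>_. 1) u v \<le> ereal (length p)"
    using min_cost_le_walk_cost[OF assms, of "\<lambda>_. 1"] by simp
  ultimately show ?thesis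
    unfolding graph_dist_def using real_of_ereal_positive_mono by fastforce
qed

text \<open>The given walk keeps the infimum finite. Between unreachable vertices it is infinite,
  and \<open>real_of_ereal\<close> would turn it into 0.\<close>

lemma le_graph_dist:
  assumes "awalk u p v" "\<And>p. awalk u p v \<Longrightarrow> c \<le> real (length p)"
  shows "c \<le> graph_dist G u v"
proof -
  have "\<mu> (\<lambda>_. 1) u v \<le> ereal (length p)"
    using min_cost_le_walk_cost[OF assms(1), of "\<lambda>_. 1"] by simp
  moreover have "ereal c \<le> \<mu> (\<lambda>_. 1) u v"
    unfolding \<mu>_def by (rule INF_greatest) (use assms(2) in auto)
  ultimately show ?thesis
    unfolding graph_dist_def by (cases "\<mu> (\<lambda>_. 1) u v") auto
qed

text \<open>Differences telescope along the walk. With \<open>le_graph_dist\<close> this gives the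
  lower bound that a Kantorovich potential has to satisfy.\<close>

lemma Lipschitz_along_awalk:
  fixes f :: "'a \<Rightarrow> real"
  assumes "\<And>a b. (a, b) \<in> parcs G \<Longrightarrow> f a - f b \<le> 1" "awalk u p v"
  shows "f u - f v \<le> real (length p)"
  using assms(2)
proof (induct p arbitrary: u)
  case Nil
  then show ?case by (simp add: awalk_Nil_iff)
next
  case (Cons e p)
  then have "(u, snd e) \<in> parcs G" "f (snd e) - f v \<le> real (length p)"
    by (auto simp: awalk_Cons_iff)
  then show ?case
    using assms(1)[of u "snd e"] by simp
qed

lemma awalk_of_rtrancl:
  assumes "(u, v) \<in> B\<^sup>*" "B \<subseteq> parcs G" "v \<in> pverts G"
  shows "\<exists>p. awalk u p v \<and> set p \<subseteq> B"
  using assms(1)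
proof (induct rule: converse_rtrancl_induct)
  case base
  show ?case
    using assms(3) by (intro exI[of _ "[]"]) (simp add: awalk_Nil_iff)
next
  case (step a b)
  then obtain p where "awalk b p v" "set p \<subseteq> B"
    by auto
  then show ?case
    using step(1) assms(2) by (intro exI[of _ "(a, b) # p"]) (auto simp: awalk_Cons_iff)
qed

end

section \<open>Walk measures as sums over neighbours\<close>

definition neighbors :: "'a pair_pre_digraph \<Rightarrow> 'a \<Rightarrow> 'a set" where
  "neighbors G x = {z. (x, z) \<in> parcs G}"

lemma wdegree_neighbors: "wdegree G w x = (\<Sum>z\<in>neighbors G x. w (x, z))"
proof -
  have "out_arcs (with_proj G) x = Pair x ` neighbors G x"
    by (auto simp: neighbors_def out_arcs_def)
  then show ?thesis
    by (simp add: wdegree_def sum.reindex inj_on_def)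
qed

context pair_graph
begin

lemma finite_neighbors [simp]: "finite (neighbors G x)"
proof -
  have "neighbors G x \<subseteq> pverts G"
    by (auto simp: neighbors_def dest: in_arcsD2)
  then show ?thesis
    using pair_finite_verts finite_subset by blast
qed

lemma not_self_neighbor [simp]: "x \<notin> neighbors G x"
  using no_loops' by (auto simp: neighbors_def)

lemma weight_le_wdegree:
  assumes "edge_weight G w" "(x, y) \<in> parcs G"
  shows "0 < w (x, y)" "w (x, y) \<le> wdegree G w x"
proof -
  show "0 < w (x, y)"
    using assms by (auto simp: edge_weight_def)
  show "w (x, y) \<le> wdegree G w x"
    unfolding wdegree_neighbors using assms
    by (intro member_le_sum finite_neighbors)
      (auto simp: edge_weight_def neighbors_def intro: less_imp_le)
qed

text \<open>\<open>embed_pmf\<close> is meaningful only for nonnegative functions of total mass 1.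
  The arc leaving \<open>x\<close> makes the weighted degree positive, so that the neighbours carry
  mass \<open>1 - \<alpha>\<close> in total.\<close>

lemma pmf_walk_measure:
  assumes "edge_weight G w" "(x, y) \<in> parcs G" "0 \<le> \<alpha>" "\<alpha> \<le> 1"
  shows "pmf (walk_measure G w \<alpha> x) z = (if z = x then \<alpha>
     else if z \<in> neighbors G x then (1 - \<alpha>) * w (x, z) / wdegree G w x else 0)"
proof -
  have D: "0 < wdegree G w x"
    using weight_le_wdegree[OF assms(1,2)] by simp
  let ?f = "\<lambda>z. if z = x then \<alpha>
     else if (x, z) \<in> parcs G then (1 - \<alpha>) * w (x, z) / wdegree G w x else 0"
  have "sum ?f (insert x (neighbors G x)) = \<alpha> + sum ?f (neighbors G x)"
    by simp
  also have "sum ?f (neighbors G x) = (\<Sum>z\<in>neighbors G x. (1 - \<alpha>) / wdegree G w x * w (x, z))"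
    using not_self_neighbor by (intro sum.cong) (auto simp: neighbors_def)
  also have "\<dots> = 1 - \<alpha>"
    using D by (simp only: sum_distrib_left[symmetric] wdegree_neighbors[symmetric]) simp
  finally have "sum ?f (insert x (neighbors G x)) = 1"
    by simp
  moreover have "0 \<le> ?f z" for z
    using assms D by (auto simp: edge_weight_def intro!: divide_nonneg_pos mult_nonneg_nonneg)
  ultimately have "pmf (embed_pmf ?f) z = ?f z"
    using finite_neighbors[of x]
    by (intro pmf_embed_pmf_finite[where A = "insert x (neighbors G x)"]) (auto simp: neighbors_def)
  then show ?thesis
    by (simp add: walk_measure_def neighbors_def)
qed

lemma set_walk_measure_subset:
  assumes "edge_weight G w" "(x, y) \<in> parcs G" "0 \<le> \<alpha>" "\<alpha> \<le> 1"
  shows "set_pmf (walk_measure G w \<alpha> x) \<subseteq> insert x (neighbors G x)"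
  by (auto simp: set_pmf_iff pmf_walk_measure[OF assms] split: if_splits)

lemma expectation_walk_measure:
  assumes "edge_weight G w" "(x, y) \<in> parcs G" "0 \<le> \<alpha>" "\<alpha> \<le> 1"
  shows "measure_pmf.expectation (walk_measure G w \<alpha> x) f =
    \<alpha> * f x + (1 - \<alpha>) * (\<Sum>z\<in>neighbors G x. w (x, z) * f z) / wdegree G w x"
proof -
  have "measure_pmf.expectation (walk_measure G w \<alpha> x) f =
      (\<Sum>z\<in>insert x (neighbors G x). f z * pmf (walk_measure G w \<alpha> x) z)"
    using set_walk_measure_subset[OF assms] by (intro integral_measure_pmf_real) auto
  also have "\<dots> = \<alpha> * f x + (\<Sum>z\<in>neighbors G x. f z * pmf (walk_measure G w \<alpha> x) z)"
    by (simp add: pmf_walk_measure[OF assms])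
  also have "(\<Sum>z\<in>neighbors G x. f z * pmf (walk_measure G w \<alpha> x) z) =
      (\<Sum>z\<in>neighbors G x. (1 - \<alpha>) / wdegree G w x * (w (x, z) * f z))"
    using not_self_neighbor by (intro sum.cong) (auto simp: pmf_walk_measure[OF assms])
  finally show ?thesis
    by (simp only: sum_distrib_left[symmetric]) simp
qed

end

section \<open>Edge potentials and the curvature formula\<close>

text \<open>
  Requiring every edge to be a bridge expresses acyclicity in terms of reachability, which is easy
  to transport through a suppression.
\<close>

locale pair_forest = pair_graph +
  assumes bridge: "(x, y) \<in> parcs G \<Longrightarrow> (x, y) \<notin> (parcs G - {(x, y), (y, x)})\<^sup>*"
begin

text \<open>An optimal Kantorovich potential for the edge: it takes the values 1, 0, -1, -2 on the
  other neighbours of \<open>x\<close>, on \<open>x\<close>, on \<open>y\<close> and on the other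
  neighbours of \<open>y\<close>. Farther vertices repeat the outer value of their side, and
  vertices of other components get -2, which keeps the function 1-Lipschitz along arcs.\<close>

definition edge_potential :: "'a \<Rightarrow> 'a \<Rightarrow> 'a \<Rightarrow> real" where
  "edge_potential x y z = (if z = x then 0 else if z = y then -1
     else if (x, z) \<in> (parcs G - {(x, y), (y, x)})\<^sup>* then 1 else -2)"

lemma edge_potential_Lipschitz:
  assumes "(x, y) \<in> parcs G" "(a, b) \<in> parcs G"
  shows "edge_potential x y a - edge_potential x y b \<le> 1"
proof (cases "(a, b) \<in> {(x, y), (y, x)}")
  case True
  then show ?thesis
    by (auto simp: edge_potential_def)
next
  case False
  let ?B = "parcs G - {(x, y), (y, x)}"
  have "(a, b) \<in> ?B" "(b, a) \<in> ?B"
    using False assms(2) arcs_symmetric by auto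
  \<comment> \<open>Any other arc stays on one side of the bridge, where the only values are 0 and
    1, or -1 and -2.\<close>
  then have "(x, a) \<in> ?B\<^sup>* \<longleftrightarrow> (x, b) \<in> ?B\<^sup>*"
    by (meson rtrancl.rtrancl_into_rtrancl)
  moreover have "(x, y) \<notin> ?B\<^sup>*"
    using bridge assms(1) by blast
  moreover have "(x, x) \<in> ?B\<^sup>*"
    by simp
  ultimately show ?thesis
    by (auto simp: edge_potential_def)
qed

lemma edge_potential_neighbor:
  assumes "(x, y) \<in> parcs G"
  shows "z \<in> neighbors G x - {y} \<Longrightarrow> edge_potential x y z = 1"
    and "z \<in> neighbors G y - {x} \<Longrightarrow> edge_potential x y z = -2"
proof -
  let ?B = "parcs G - {(x, y), (y, x)}"
  show "edge_potential x y z = 1" if "z \<in> neighbors G x - {y}"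
  proof -
    have "(x, z) \<in> ?B" "z \<noteq> x"
      using that no_loops'[of x z] by (auto simp: neighbors_def)
    then show ?thesis
      using that by (auto simp: edge_potential_def)
  qed
  show "edge_potential x y z = -2" if "z \<in> neighbors G y - {x}"
  proof -
    have "(z, y) \<in> ?B" "z \<noteq> y" "z \<noteq> x"
      using that no_loops'[of y z] arcs_symmetric by (auto simp: neighbors_def)
    then have "(x, z) \<notin> ?B\<^sup>*"
      using bridge[OF assms] by (meson rtrancl.rtrancl_into_rtrancl)
    then show ?thesis
      using \<open>z \<noteq> y\<close> \<open>z \<noteq> x\<close> by (simp add: edge_potential_def)
  qed
qed

text \<open>The walk goes from \<open>u\<close> to \<open>x\<close> and on to \<open>v\<close>,
  crossing to \<open>y\<close> where needed; each arc lowers the potential by exactly 1. The start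
  \<open>y\<close> is excluded because the potential rises from \<open>y\<close> to
  \<open>x\<close>.\<close>

lemma awalk_across_edge:
  assumes "(x, y) \<in> parcs G" "u \<in> insert x (neighbors G x)" "v \<in> insert y (neighbors G y)" "u \<noteq> y"
  shows "\<exists>p. awalk u p v \<and> real (length p) = edge_potential x y u - edge_potential x y v"
proof -
  note pot = edge_potential_neighbor[OF assms(1)]
  have xy: "x \<in> pverts G" "y \<in> pverts G" "x \<noteq> y"
    using assms(1) in_arcsD1 in_arcsD2 no_loops' by auto
  obtain p where p: "awalk u p x" "real (length p) = edge_potential x y u"
  proof (cases "u = x")
    case True
    then show ?thesis
      using xy that[of "[]"] by (simp add: awalk_Nil_iff edge_potential_def)
  next
    case False
    then have "(u, x) \<in> parcs G" "edge_potential x y u = 1"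
      using assms(2,4) arcs_symmetric pot(1)[of u] by (auto simp: neighbors_def)
    then show ?thesis
      using xy that[of "[(u, x)]"] by (auto simp: awalk_simps dest: in_arcsD1)
  qed
  obtain q where q: "awalk x q v" "real (length q) = - edge_potential x y v"
  proof -
    consider "v = x" | "v = y" | "v \<in> neighbors G y - {x}"
      using assms(3) by auto
    then show ?thesis
    proof cases
      case 1
      then show ?thesis
        using xy that[of "[]"] by (simp add: awalk_Nil_iff edge_potential_def)
    next
      case 2
      then show ?thesis
        using xy assms(1) that[of "[(x, y)]"] by (simp add: awalk_simps edge_potential_def)
    next
      case 3
      then show ?thesis
        using xy assms(1) that[of "[(x, y), (y, v)]"] pot(2)[OF 3]
        by (auto simp: awalk_simps neighbors_def dest: in_arcsD2)
    qed
  qed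
  have "awalk u (p @ q) v"
    using p(1) q(1) by (rule awalk_appendI)
  then show ?thesis
    using p(2) q(2) by (intro exI[of _ "p @ q"]) simp
qed

text \<open>The potential is tight for all mass that moves. The bound
  \<open>1 / 2 \<le> \<alpha>\<close> ensures that the mass of the first measure at
  \<open>y\<close>, which is at most \<open>1 - \<alpha>\<close>, fits into the mass
  \<open>\<alpha>\<close> of the second and can stay in place.\<close>

lemma curvature_edge:
  assumes "edge_weight G w" "(x, y) \<in> parcs G"
    and "1 / 2 \<le> \<alpha>" "\<alpha> < 1"
  shows "curvature G w \<alpha> x y =
    (1 - \<alpha>) * (2 * w (x, y) / wdegree G w x + 2 * w (x, y) / wdegree G w y - 2)"
proof -
  let ?f = "edge_potential x y" and ?d = "graph_dist G"
  let ?p = "walk_measure G w \<alpha> x" and ?q = "walk_measure G w \<alpha> y"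
  note pot = edge_potential_neighbor[OF assms(2)]
  have yx: "(y, x) \<in> parcs G" "w (y, x) = w (x, y)" "x \<noteq> y"
    using assms arcs_symmetric no_loops' by (auto simp: edge_weight_def)
  have \<alpha>: "0 \<le> \<alpha>" "\<alpha> \<le> 1"
    using assms by auto
  note W = weight_le_wdegree[OF assms(1,2)] weight_le_wdegree[OF assms(1) yx(1)]
  note sets = set_walk_measure_subset[OF assms(1,2) \<alpha>] set_walk_measure_subset[OF assms(1) yx(1) \<alpha>]
  have vals: "?f x = 0" "?f y = -1"
    using yx by (auto simp: edge_potential_def)
  \<comment> \<open>Finiteness of the distances is needed for all pairs, including those starting at
    \<open>y\<close>, for which the walk first steps back to \<open>x\<close>.\<close>
  have reach: "\<exists>p. awalk u p v" if "u \<in> set_pmf ?p" "v \<in> set_pmf ?q" for u v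
  proof (cases "u = y")
    case True
    have "awalk y [(y, x)] x"
      using yx(1) in_arcsD1 in_arcsD2 by (auto simp: awalk_simps)
    moreover have "\<exists>p. awalk x p v"
      using awalk_across_edge[OF assms(2), of x v] that(2) sets(2) yx(3) by blast
    ultimately show ?thesis
      using True awalk_appendI by blast
  next
    case False
    then show ?thesis
      using awalk_across_edge[OF assms(2)] that sets by blast
  qed
  have "wasserstein1 ?d ?p ?q = measure_pmf.expectation ?p ?f - measure_pmf.expectation ?q ?f"
  proof (rule wasserstein1_eq_potential[where y = y])
    show "finite (set_pmf ?p)" "finite (set_pmf ?q)"
      using sets finite_neighbors finite_subset by (metis finite_insert)+
    show "?f u - ?f v \<le> ?d u v" if "u \<in> set_pmf ?p" "v \<in> set_pmf ?q" for u v
      using reach[OF that] Lipschitz_along_awalk[of ?f, OF edge_potential_Lipschitz[OF assms(2)]]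
      by (blast intro: le_graph_dist)
    show "?d u v \<le> ?f u - ?f v" if "u \<in> set_pmf ?p" "v \<in> set_pmf ?q" "u \<noteq> y" for u v
    proof -
      have "u \<in> insert x (neighbors G x)" "v \<in> insert y (neighbors G y)"
        using that sets by blast+
      then obtain p where "awalk u p v" "real (length p) = ?f u - ?f v"
        using awalk_across_edge[OF assms(2)] \<open>u \<noteq> y\<close> by blast
      then show ?thesis
        using graph_dist_le[of u p v] by simp
    qed
    have "awalk y [] y"
      using in_arcsD1[OF yx(1)] by (simp add: awalk_Nil_iff)
    then show "?d y y = 0"
      using graph_dist_le[of y "[]" y] le_graph_dist[of y "[]" y 0] by simp
    have "pmf ?p y = (1 - \<alpha>) * (w (x, y) / wdegree G w x)"
      using yx assms(2) by (simp add: pmf_walk_measure[OF assms(1,2) \<alpha>] neighbors_def)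
    also have "\<dots> \<le> (1 - \<alpha>) * 1"
      using W \<alpha> by (intro mult_left_mono) auto
    finally have "pmf ?p y \<le> 1 / 2"
      using assms(3) by simp
    moreover have "pmf ?q y = \<alpha>"
      by (simp add: pmf_walk_measure[OF assms(1) yx(1) \<alpha>])
    ultimately show "pmf ?p y \<le> pmf ?q y" "pmf ?p y < 1"
      using assms(3) by auto
  qed
  also have "measure_pmf.expectation ?p ?f =
      (1 - \<alpha>) * (wdegree G w x - 2 * w (x, y)) / wdegree G w x"
  proof -
    have y: "y \<in> neighbors G x"
      using assms(2) by (simp add: neighbors_def)
    have "(\<Sum>z\<in>neighbors G x. w (x, z) * ?f z) =
        - w (x, y) + (\<Sum>z\<in>neighbors G x - {y}. w (x, z))"
      using y vals pot(1) by (simp add: sum.remove[OF finite_neighbors y])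
    also have "\<dots> = wdegree G w x - 2 * w (x, y)"
      unfolding wdegree_neighbors using sum.remove[OF finite_neighbors y, of "\<lambda>z. w (x, z)"] by simp
    finally show ?thesis
      by (simp add: expectation_walk_measure[OF assms(1,2) \<alpha>] vals)
  qed
  also have "measure_pmf.expectation ?q ?f =
      - \<alpha> + (1 - \<alpha>) * (2 * w (x, y) - 2 * wdegree G w y) / wdegree G w y"
  proof -
    have x: "x \<in> neighbors G y"
      using yx by (simp add: neighbors_def)
    have "(\<Sum>z\<in>neighbors G y. w (y, z) * ?f z) =
        (\<Sum>z\<in>neighbors G y - {x}. - 2 * w (y, z))"
      using vals pot(2) by (simp add: sum.remove[OF finite_neighbors x] mult.commute)
    also have "\<dots> = 2 * w (x, y) - 2 * wdegree G w y"
      unfolding wdegree_neighbors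
      using sum.remove[OF finite_neighbors x, of "\<lambda>z. w (y, z)"] yx
      by (simp only: sum_distrib_left[symmetric]) simp
    finally show ?thesis
      by (simp add: expectation_walk_measure[OF assms(1) yx(1) \<alpha>] vals)
  qed
  finally show ?thesis
    using W by (simp add: curvature_def field_simps)
qed

lemma LLY_curvature_edge:
  assumes "edge_weight G w" "(x, y) \<in> parcs G"
  shows "LLY_curvature G w x y =
    2 * (w (x, y) / wdegree G w x + w (x, y) / wdegree G w y - 1)" (is "_ = ?k")
  unfolding LLY_curvature_def
proof (rule tendsto_Lim)
  \<comment> \<open>The quotient does not depend on \<open>\<alpha>\<close> in this range, so it
    equals its limit.\<close>
  have "\<forall>\<^sub>F \<alpha> in at_left 1. \<alpha> \<in> {1 / 2<..<1 :: real}"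
    by (rule eventually_at_leftI[of "1 / 2"]) auto
  then have "\<forall>\<^sub>F \<alpha> in at_left 1. curvature G w \<alpha> x y / (1 - \<alpha>) = ?k"
    by eventually_elim (simp add: curvature_edge[OF assms])
  then show "((\<lambda>\<alpha>. curvature G w \<alpha> x y / (1 - \<alpha>)) \<longlongrightarrow> ?k) (at_left 1)"
    by (rule tendsto_eventually)
qed simp

lemma admissible_iff:
  "admissible G w \<longleftrightarrow> edge_weight G w \<and>
    (\<forall>(x, y) \<in> parcs G. 1 \<le> w (x, y) / wdegree G w x + w (x, y) / wdegree G w y)"
  unfolding admissible_def by (auto simp: LLY_curvature_edge)

end

text \<open>A connection from \<open>x\<close> to \<open>y\<close> that avoids the edge, shortened
  to a path and closed by the arc \<open>(y, x)\<close>, would be a cycle of length at least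
  3.\<close>

lemma pair_forest_finite_tree:
  assumes "finite_tree T"
  shows "pair_forest T"
proof -
  interpret pair_graph T
    using assms by (simp add: finite_tree_def)
  show ?thesis
  proof
    fix x y
    assume xy: "(x, y) \<in> parcs T"
    let ?B = "parcs T - {(x, y), (y, x)}"
    show "(x, y) \<notin> ?B\<^sup>*"
    proof
      assume "(x, y) \<in> ?B\<^sup>*"
      then obtain p where p: "awalk x p y" "set p \<subseteq> ?B"
        using awalk_of_rtrancl[of x y ?B] in_arcsD2[OF xy] by blast
      define q where "q = awalk_to_apath p"
      have q: "apath x q y" "set q \<subseteq> ?B"
        using apath_awalk_to_apath[OF p(1)] awalk_to_apath_subset[OF p(1)] p(2)
        by (auto simp: q_def)
      \<comment> \<open>The empty path would give \<open>x = y\<close>, and a single arc would be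
        the removed \<open>(x, y)\<close>.\<close>
      then have "2 \<le> length q"
        using no_loops'[OF xy]
        by (cases q; cases "tl q") (auto simp: apath_def awalk_simps)
      moreover have "cycle ((y, x) # q)"
        unfolding cycle_def
        using q arcs_symmetric[OF xy] in_arcsD2[OF xy]
        by (intro exI[of _ y]) (auto simp: apath_def awalk_Cons_iff)
      ultimately show False
        using assms unfolding finite_tree_def by force
    qed
  qed
qed

subsection \<open>Suppression\<close>

text \<open>If every new weight lies between two old ones, the supremum does not grow and the
  infimum does not shrink.\<close>

lemma distortion_le:
  assumes "parcs H \<noteq> {}" "\<And>e. e \<in> parcs G \<Longrightarrow> 0 \<le> w e"
    and upper: "\<And>e. e \<in> parcs H \<Longrightarrow> \<exists>e'\<in>parcs G. w' e \<le> w e'"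
    and lower: "\<And>e. e \<in> parcs H \<Longrightarrow> \<exists>e'\<in>parcs G. w e' \<le> w' e"
  shows "distortion H w' \<le> distortion G w"
proof -
  define M where "M = (SUP e\<in>parcs G. ereal (w e))"
  define m where "m = (INF e\<in>parcs G. ereal (w e))"
  define M' where "M' = (SUP e\<in>parcs H. ereal (w' e))"
  define m' where "m' = (INF e\<in>parcs H. ereal (w' e))"
  have "M' \<le> M" "m \<le> m'"
    unfolding M_def M'_def m_def m'_def using upper lower by (auto intro!: SUP_mono INF_mono)
  \<comment> \<open>Fails without arcs in \<open>H\<close>, where the supremum is
    \<open>-\<infinity>\<close> and the infimum \<open>\<infinity>\<close>.\<close>
  moreover have "m' \<le> M'"
    unfolding M'_def m'_def by (rule INF_le_SUP) fact
  moreover have "0 \<le> m"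
    unfolding m_def using assms(2) by (intro INF_greatest) simp
  ultimately have "M' / m' \<le> M / m \<and> m' \<noteq> 0 \<and> M' \<noteq> \<infinity>" if "M \<noteq> \<infinity>" "m \<noteq> 0"
    using that by (cases M; cases m; cases M'; cases m') (auto intro: frac_le)
  moreover have "distortion G w = (if M = \<infinity> \<or> m = 0 then \<infinity> else M / m)"
    "distortion H w' = (if M' = \<infinity> \<or> m' = 0 then \<infinity> else M' / m')"
    by (simp_all add: distortion_def M_def m_def M'_def m'_def Let_def)
  ultimately show ?thesis
    by auto
qed

section \<open>Decay of weights along non-backtracking walks\<close>

text \<open>The final arcs of the non-backtracking walks that start along \<open>(v, x)\<close>.\<close>

inductive_set forward_arcs :: "'a pair_pre_digraph \<Rightarrow> 'a \<Rightarrow> 'a \<Rightarrow> ('a \<times> 'a) set"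
  for G v x where
    start: "(v, x) \<in> forward_arcs G v x"
  | step: "(t, u) \<in> forward_arcs G v x \<Longrightarrow> (u, z) \<in> parcs G \<Longrightarrow> z \<noteq> t \<Longrightarrow>
      (u, z) \<in> forward_arcs G v x"

text \<open>A step back to \<open>t\<close> cancels the last arc, and the arc before it already ends
  in \<open>t\<close>. Only the starting arc has no predecessor, and a step back along it is ruled
  out by the removal of the edge \<open>xv\<close>.\<close>

lemma rtrancl_forward_arcs:
  assumes "(x, u) \<in> (parcs G - {(x, v), (v, x)})\<^sup>*"
  shows "\<exists>t. (t, u) \<in> forward_arcs G v x"
  using assms
proof (induct rule: rtrancl_induct)
  case base
  show ?case
    by (blast intro: forward_arcs.start)
next
  case (step u z)
  then obtain t where t: "(t, u) \<in> forward_arcs G v x"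
    by blast
  show ?case
  proof (cases "z = t")
    case True
    then show ?thesis
      using t step(2) by (auto elim: forward_arcs.cases)
  next
    case False
    then show ?thesis
      using t step(2) by (blast intro: forward_arcs.step)
  qed
qed

context pair_forest
begin

lemma two_weights_le_wdegree:
  assumes "edge_weight G w" "(u, t) \<in> parcs G" "(u, z) \<in> parcs G" "z \<noteq> t"
  shows "w (u, t) + w (u, z) \<le> wdegree G w u"
proof -
  have "w (u, t) + w (u, z) = (\<Sum>z\<in>{t, z}. w (u, z))"
    using assms(4) by simp
  also have "\<dots> \<le> wdegree G w u"
    unfolding wdegree_neighbors using assms
    by (intro sum_mono2 finite_neighbors)
      (auto simp: edge_weight_def neighbors_def intro: less_imp_le)
  finally show ?thesis .
qed

text \<open>The bound \<open>wdegree G w u \<le> 2 * w (t, u)\<close> is the invariant. It makes any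
  further edge \<open>uz\<close> at most as heavy as \<open>tu\<close>, hence at most half of the
  degree of \<open>u\<close>; admissibility then makes \<open>uz\<close> at least half of the degree
  of \<open>z\<close>, which is the invariant at \<open>z\<close>.\<close>

lemma forward_arcs_weight_le:
  assumes "admissible G w" "(v, x) \<in> parcs G" "wdegree G w x \<le> 2 * w (v, x)"
    and "(t, u) \<in> forward_arcs G v x"
  shows "(t, u) \<in> parcs G \<and> w (t, u) \<le> w (v, x) \<and> wdegree G w u \<le> 2 * w (t, u)"
  using assms(4)
proof induct
  case start
  then show ?case
    using assms by simp
next
  case (step t u z)
  have ew: "edge_weight G w"
    using assms(1) by (simp add: admissible_iff)
  have sym: "(u, t) \<in> parcs G" "w (u, t) = w (t, u)" "(z, u) \<in> parcs G"
    using step arcs_symmetric ew by (auto simp: edge_weight_def)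
  have s: "w (u, z) \<le> w (t, u)" "2 * w (u, z) \<le> wdegree G w u"
    using two_weights_le_wdegree[OF ew sym(1) step(3,4)] step(2) sym(2) by auto
  note W = weight_le_wdegree[OF ew step(3)] weight_le_wdegree[OF ew sym(3)]
  have "1 \<le> w (u, z) / wdegree G w u + w (u, z) / wdegree G w z"
    using assms(1) step(3) by (auto simp: admissible_iff)
  moreover have "w (u, z) / wdegree G w u \<le> 1 / 2"
    using s(2) W by (simp add: field_simps)
  ultimately have "1 / 2 \<le> w (u, z) / wdegree G w z"
    by linarith
  then have "wdegree G w z \<le> 2 * w (u, z)"
    using W by (simp add: field_simps)
  then show ?case
    using step s by auto
qed

text \<open>An edge at \<open>u\<close> is either the one by which a non-backtracking walk enters
  \<open>u\<close>, or shares the degree of \<open>u\<close> with it and is no heavier by the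
  invariant.\<close>

lemma weight_le_beyond:
  assumes "admissible G w" "(v, x) \<in> parcs G" "wdegree G w x \<le> 2 * w (v, x)"
    and "(x, u) \<in> (parcs G - {(x, v), (v, x)})\<^sup>*" "(u, b) \<in> parcs G"
  shows "w (u, b) \<le> w (v, x)"
proof -
  obtain t where "(t, u) \<in> forward_arcs G v x"
    using rtrancl_forward_arcs[OF assms(4)] by blast
  from forward_arcs_weight_le[OF assms(1-3) this]
  have t: "(t, u) \<in> parcs G" "w (t, u) \<le> w (v, x)" "wdegree G w u \<le> 2 * w (t, u)"
    by auto
  have ew: "edge_weight G w"
    using assms(1) by (simp add: admissible_iff)
  have sym: "(u, t) \<in> parcs G" "w (u, t) = w (t, u)"
    using t arcs_symmetric ew by (auto simp: edge_weight_def)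
  show ?thesis
    using two_weights_le_wdegree[OF ew sym(1) assms(5)] t sym by (cases "b = t") auto
qed

end

section \<open>A single suppression and its weight\<close>

text \<open>The roles of \<open>x\<close> and \<open>y\<close> differ: the side of \<open>x\<close>
  is the one to be rescaled. The locale is instantiated with both orders of the two
  neighbours.\<close>

locale degree_two_vertex = pair_forest +
  fixes v x y
  assumes neighbors_v: "neighbors G v = {x, y}" and x_neq_y: "x \<noteq> y"
begin

abbreviation "H \<equiv> suppress G v x y"

lemma v_arcs: "(v, x) \<in> parcs G" "(x, v) \<in> parcs G" "(v, y) \<in> parcs G" "(y, v) \<in> parcs G"
  "x \<noteq> v" "y \<noteq> v" "v \<noteq> x" "v \<noteq> y"
proof -
  show "(v, x) \<in> parcs G" "(v, y) \<in> parcs G"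
    using neighbors_v by (auto simp: neighbors_def)
  then show "(x, v) \<in> parcs G" "(y, v) \<in> parcs G" "x \<noteq> v" "y \<noteq> v" "v \<noteq> x" "v \<noteq> y"
    using arcs_symmetric no_loops' by auto
qed

text \<open>A triangle would bypass the bridge \<open>xv\<close> through \<open>y\<close>. Hence the
  edge added by the suppression is really new and gets its weight without conflict.\<close>

lemma not_adjacent: "(x, y) \<notin> parcs G" "(y, x) \<notin> parcs G"
proof -
  show "(x, y) \<notin> parcs G"
  proof
    assume "(x, y) \<in> parcs G"
    then have "(x, y) \<in> parcs G - {(x, v), (v, x)}" "(y, v) \<in> parcs G - {(x, v), (v, x)}"
      using v_arcs x_neq_y by auto
    then have "(x, v) \<in> (parcs G - {(x, v), (v, x)})\<^sup>*"
      by (meson r_into_rtrancl rtrancl.rtrancl_into_rtrancl)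
    then show False
      using bridge v_arcs(2) by blast
  qed
  then show "(y, x) \<notin> parcs G"
    using arcs_symmetric by blast
qed

lemma neighbors_v_only:
  assumes "(a, v) \<in> parcs G \<or> (v, a) \<in> parcs G"
  shows "a = x \<or> a = y"
  using assms arcs_symmetric neighbors_v by (auto simp: neighbors_def)

lemma arcs_suppress:
  "(a, b) \<in> parcs H \<longleftrightarrow> (a, b) \<in> parcs G \<and> a \<noteq> v \<and> b \<noteq> v \<or> (a, b) = (x, y) \<or> (a, b) = (y, x)"
  using neighbors_v_only[of a] neighbors_v_only[of b] v_arcs by (auto simp: suppress_def)

lemma arc_suppress_cases:
  assumes "(a, b) \<in> parcs H"
  obtains "(a, b) \<in> parcs G" "a \<noteq> v" "b \<noteq> v" | "a = x" "b = y" | "a = y" "b = x"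
  using assms unfolding arcs_suppress by blast

lemma pair_forest_suppress: "pair_forest H"
proof
  have ends: "a \<in> pverts G - {v} \<and> b \<in> pverts G - {v} \<and> a \<noteq> b" if "(a, b) \<in> parcs H" for a b
    using that arcs_suppress v_arcs x_neq_y no_loops' in_arcsD1 in_arcsD2
    by (metis Diff_iff Pair_inject singletonD)
  show "fst e \<in> pverts H" "snd e \<in> pverts H" "fst e \<noteq> snd e" if "e \<in> parcs H" for e
    using ends[of "fst e" "snd e"] that by (simp_all add: suppress_def)
  show "finite (pverts H)" "finite (parcs H)"
    using pair_finite_verts pair_finite_arcs by (auto simp: suppress_def)
  show "symmetric (with_proj H)"
    using arcs_symmetric by (auto simp: symmetric_def sym_def arcs_suppress)
  fix a b
  assume ab: "(a, b) \<in> parcs H"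
  show "(a, b) \<notin> (parcs H - {(a, b), (b, a)})\<^sup>*"
  proof
    assume cyc: "(a, b) \<in> (parcs H - {(a, b), (b, a)})\<^sup>*"
    from ab show False
    proof (cases rule: arc_suppress_cases)
      \<comment> \<open>A bypass of an old edge lifts to \<open>G\<close>, with each use of the new
        edge replaced by the detour through \<open>v\<close>.\<close>
      case 1
      let ?C = "parcs G - {(a, b), (b, a)}"
      have "(x, v) \<in> ?C" "(v, x) \<in> ?C" "(y, v) \<in> ?C" "(v, y) \<in> ?C"
        using v_arcs 1 by auto
      then have xy: "(x, y) \<in> ?C\<^sup>*" "(y, x) \<in> ?C\<^sup>*"
        by (meson r_into_rtrancl rtrancl.rtrancl_into_rtrancl)+
      have "parcs H - {(a, b), (b, a)} \<subseteq> ?C\<^sup>*"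
      proof (rule subrelI)
        fix c d
        assume cd: "(c, d) \<in> parcs H - {(a, b), (b, a)}"
        then have "(c, d) \<in> parcs H"
          by blast
        then show "(c, d) \<in> ?C\<^sup>*"
          using cd xy by (cases rule: arc_suppress_cases) auto
      qed
      then have "(a, b) \<in> ?C\<^sup>*"
        using cyc rtrancl_subset_rtrancl by blast
      then show False
        using bridge 1 by blast
    next
      \<comment> \<open>A bypass of the new edge consists of old arcs away from \<open>v\<close>;
        continued by \<open>(y, v)\<close> it bypasses the bridge \<open>xv\<close>.\<close>
      case 2
      let ?C = "parcs G - {(x, v), (v, x)}"
      have "parcs H - {(a, b), (b, a)} \<subseteq> ?C"
        using 2 by (auto simp: arcs_suppress)
      then have "(x, y) \<in> ?C\<^sup>*"
        using cyc 2 rtrancl_mono by blast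
      moreover have "(y, v) \<in> ?C"
        using v_arcs x_neq_y by auto
      ultimately have "(x, v) \<in> ?C\<^sup>*"
        by (rule rtrancl.rtrancl_into_rtrancl)
      then show False
        using bridge v_arcs by blast
    next
      case 3
      let ?C = "parcs G - {(y, v), (v, y)}"
      have "parcs H - {(a, b), (b, a)} \<subseteq> ?C"
        using 3 by (auto simp: arcs_suppress)
      then have "(y, x) \<in> ?C\<^sup>*"
        using cyc 3 rtrancl_mono by blast
      moreover have "(x, v) \<in> ?C"
        using v_arcs x_neq_y by auto
      ultimately have "(y, v) \<in> ?C\<^sup>*"
        by (rule rtrancl.rtrancl_into_rtrancl)
      then show False
        using bridge v_arcs by blast
    qed
  qed
qed

definition "x_side = {u. (x, u) \<in> (parcs G - {(x, v), (v, x)})\<^sup>*}"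

lemma x_side_members: "x \<in> x_side" "v \<notin> x_side" "y \<notin> x_side"
proof -
  let ?C = "parcs G - {(x, v), (v, x)}"
  show "x \<in> x_side" "v \<notin> x_side"
    using bridge v_arcs by (auto simp: x_side_def)
  have "(y, v) \<in> ?C"
    using v_arcs x_neq_y by auto
  then show "y \<notin> x_side"
    using bridge[OF v_arcs(2)] by (auto simp: x_side_def intro: rtrancl.rtrancl_into_rtrancl)
qed

lemma x_side_arc:
  assumes "(a, b) \<in> parcs G" "a \<noteq> v" "b \<noteq> v"
  shows "a \<in> x_side \<longleftrightarrow> b \<in> x_side"
proof -
  have "(a, b) \<in> parcs G - {(x, v), (v, x)}" "(b, a) \<in> parcs G - {(x, v), (v, x)}"
    using assms arcs_symmetric by auto
  then show ?thesis
    unfolding x_side_def by (auto intro: rtrancl.rtrancl_into_rtrancl)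
qed

text \<open>The factor q/p, with p = \<open>w (v, x)\<close> and q = \<open>w (v, y)\<close>, turns
  the weight p of \<open>xv\<close> into q. So the new edge can replace \<open>xv\<close> on the
  scaled side and \<open>yv\<close> on the unscaled side. Testing only \<open>a\<close> is enough,
  since an old edge that avoids \<open>v\<close> has both ends on the same side.\<close>

definition suppressed_weight :: "('a \<times> 'a) weight_fun \<Rightarrow> ('a \<times> 'a) weight_fun" where
  "suppressed_weight w = (\<lambda>(a, b). if (a, b) = (x, y) \<or> (a, b) = (y, x) then w (v, y)
     else if a \<in> x_side then w (v, y) / w (v, x) * w (a, b) else w (a, b))"

lemma suppressed_weight_new [simp]:
  "suppressed_weight w (x, y) = w (v, y)" "suppressed_weight w (y, x) = w (v, y)"
  by (simp_all add: suppressed_weight_def)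

lemma suppressed_weight_old:
  assumes "(a, b) \<in> parcs G"
  shows "suppressed_weight w (a, b) = (if a \<in> x_side then w (v, y) / w (v, x) else 1) * w (a, b)"
  using assms not_adjacent by (auto simp: suppressed_weight_def)

lemma edge_weight_suppressed:
  assumes "edge_weight G w"
  shows "edge_weight H (suppressed_weight w)"
  unfolding edge_weight_def
proof clarify
  fix a b
  assume ab: "(a, b) \<in> parcs H"
  have "0 < w (v, x)" "0 < w (v, y)"
    using assms v_arcs by (auto simp: edge_weight_def)
  with ab show "0 < suppressed_weight w (a, b) \<and> suppressed_weight w (a, b) = suppressed_weight w (b, a)"
    using assms x_side_arc[of a b] arcs_symmetric[of a b]
    by (cases rule: arc_suppress_cases) (auto simp: suppressed_weight_old edge_weight_def)
qed

text \<open>At \<open>x\<close> and \<open>y\<close> the new edge replaces the edge to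
  \<open>v\<close> and weighs exactly its scaled weight; at all other vertices the neighbourhood is
  unchanged.\<close>

lemma wdegree_suppressed:
  assumes "edge_weight G w" "u \<noteq> v"
  shows "wdegree H (suppressed_weight w) u =
    (if u \<in> x_side then w (v, y) / w (v, x) else 1) * wdegree G w u"
proof -
  let ?w = "suppressed_weight w" and ?c = "if u \<in> x_side then w (v, y) / w (v, x) else 1"
  have pos: "0 < w (v, x)" "w (x, v) = w (v, x)" "w (y, v) = w (v, y)"
    using assms(1) v_arcs by (auto simp: edge_weight_def)
  have w: "?w (u, z) = ?c * w (u, z)" if "(u, z) \<in> parcs G" for z
    using that by (rule suppressed_weight_old)
  show ?thesis
  proof (cases "u = x \<or> u = y")
    case True
    \<comment> \<open>The neighbour that takes the place of \<open>v\<close>.\<close>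
    define n where "n = (if u = x then y else x)"
    have n: "(u, v) \<in> parcs G" "(u, n) \<notin> parcs G" "?w (u, n) = ?c * w (u, v)"
      using True v_arcs not_adjacent x_side_members pos x_neq_y by (auto simp: n_def)
    have "neighbors H u = insert n (neighbors G u - {v})"
      using True x_neq_y assms(2) v_arcs
      by (auto simp: n_def neighbors_def arcs_suppress split: if_splits)
    moreover have "n \<notin> neighbors G u" "v \<in> neighbors G u"
      using n by (auto simp: neighbors_def)
    moreover have "(\<Sum>z\<in>neighbors G u - {v}. ?w (u, z)) = (\<Sum>z\<in>neighbors G u - {v}. ?c * w (u, z))"
      using w by (intro sum.cong) (auto simp: neighbors_def)
    ultimately have "wdegree H ?w u = (\<Sum>z\<in>neighbors G u. ?c * w (u, z))"
      using n(3) by (simp add: wdegree_neighbors sum.remove[of "neighbors G u" v])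
    then show ?thesis
      by (simp only: wdegree_neighbors sum_distrib_left)
  next
    case False
    then have "neighbors H u = neighbors G u"
      using assms(2) neighbors_v_only[of u] by (auto simp: neighbors_def arcs_suppress)
    moreover have "(\<Sum>z\<in>neighbors G u. ?w (u, z)) = (\<Sum>z\<in>neighbors G u. ?c * w (u, z))"
      using w by (intro sum.cong) (auto simp: neighbors_def)
    ultimately show ?thesis
      by (simp only: wdegree_neighbors sum_distrib_left)
  qed
qed

lemma admissible_at_v:
  assumes "admissible G w"
  shows "1 \<le> w (v, x) / wdegree G w x + w (v, x) / (w (v, x) + w (v, y))"
    and "1 \<le> w (v, y) / wdegree G w y + w (v, y) / (w (v, x) + w (v, y))"
proof -
  have "wdegree G w v = w (v, x) + w (v, y)"
    using x_neq_y by (simp add: wdegree_neighbors neighbors_v)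
  then show "1 \<le> w (v, x) / wdegree G w x + w (v, x) / (w (v, x) + w (v, y))"
    "1 \<le> w (v, y) / wdegree G w y + w (v, y) / (w (v, x) + w (v, y))"
    using assms v_arcs unfolding admissible_iff by fastforce+
qed

text \<open>On an old edge the weight and both end degrees carry the same factor, so the condition
  is unchanged. On the new edge the factor cancels to p at \<open>x\<close>, which leaves the
  inequality \<open>new\<close>.\<close>

lemma admissible_suppressed:
  assumes "admissible G w"
  shows "admissible H (suppressed_weight w)"
proof -
  interpret H: pair_forest H
    by (rule pair_forest_suppress)
  let ?w = "suppressed_weight w"
  have ew: "edge_weight G w"
    using assms by (simp add: admissible_iff)
  have pos: "0 < w (v, x)" "0 < w (v, y)"
    using ew v_arcs by (auto simp: edge_weight_def)
  note deg = wdegree_suppressed[OF ew]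
  have new: "1 \<le> w (v, x) / wdegree G w x + w (v, y) / wdegree G w y"
  proof -
    \<comment> \<open>The two shares at \<open>v\<close> add up to 1, so adding the conditions on
      \<open>vx\<close> and \<open>vy\<close> leaves \<open>new\<close>.\<close>
    have "w (v, x) / (w (v, x) + w (v, y)) + w (v, y) / (w (v, x) + w (v, y)) = 1"
      using pos by (simp add: add_divide_distrib[symmetric])
    then show ?thesis
      using admissible_at_v[OF assms] by simp
  qed
  have "1 \<le> ?w (a, b) / wdegree H ?w a + ?w (a, b) / wdegree H ?w b" if "(a, b) \<in> parcs H" for a b
  proof -
    from that show ?thesis
    proof (cases rule: arc_suppress_cases)
      case 1
      then have "1 \<le> w (a, b) / wdegree G w a + w (a, b) / wdegree G w b"
        using assms by (auto simp: admissible_iff)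
      then show ?thesis
        using 1 x_side_arc[OF 1] pos by (simp add: deg suppressed_weight_old)
    next
      case 2
      then show ?thesis
        using new x_side_members v_arcs pos by (simp add: deg add.commute)
    next
      case 3
      then show ?thesis
        using new x_side_members v_arcs pos by (simp add: deg add.commute)
    qed
  qed
  then show ?thesis
    using edge_weight_suppressed[OF ew] by (auto simp: H.admissible_iff)
qed

text \<open>The order p \<le> q enters twice: it starts the decay that bounds the weights beyond
  \<open>x\<close> by p, and it makes the factor q/p at least 1. A scaled weight thus lies between
  its old value and q.\<close>

lemma distortion_suppressed_le:
  assumes "admissible G w" "w (v, x) \<le> w (v, y)"
  shows "distortion H (suppressed_weight w) \<le> distortion G w"
proof (rule distortion_le)
  let ?w = "suppressed_weight w"
  have ew: "edge_weight G w"
    using assms by (simp add: admissible_iff)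
  then have nonneg: "0 < w e" if "e \<in> parcs G" for e
    using that by (auto simp: edge_weight_def)
  then show "\<And>e. e \<in> parcs G \<Longrightarrow> 0 \<le> w e"
    using less_imp_le by blast
  have pos: "0 < w (v, x)" "0 < w (v, y)"
    using nonneg v_arcs by auto
  show "parcs H \<noteq> {}"
    using arcs_suppress[of x y] by auto
  \<comment> \<open>The lighter edge has at most half of the degree of \<open>v\<close>, so
    admissibility gives it at least half of the degree of \<open>x\<close>.\<close>
  have deg: "wdegree G w x \<le> 2 * w (v, x)"
  proof -
    have "w (v, x) / (w (v, x) + w (v, y)) \<le> 1 / 2"
      using assms(2) pos by (simp add: field_simps)
    then have "1 / 2 \<le> w (v, x) / wdegree G w x"
      using admissible_at_v(1)[OF assms(1)] by linarith
    moreover have "0 < wdegree G w x"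
      using weight_le_wdegree[OF ew v_arcs(2)] by simp
    ultimately show ?thesis
      by (simp add: field_simps)
  qed
  fix e
  assume e: "e \<in> parcs H"
  obtain a b where ab: "e = (a, b)"
    by fastforce
  from e[unfolded ab] have "(\<exists>e'\<in>parcs G. ?w e \<le> w e') \<and> (\<exists>e'\<in>parcs G. w e' \<le> ?w e)"
  proof (cases rule: arc_suppress_cases)
    case 1
    show ?thesis
    proof (cases "a \<in> x_side")
      case True
      have we: "?w e = w (v, y) / w (v, x) * w (a, b)"
        using True 1 ab by (simp add: suppressed_weight_old)
      have le: "w (a, b) \<le> w (v, x)"
        using weight_le_beyond[OF assms(1) v_arcs(1) deg _ 1(1)] True by (simp add: x_side_def)
      have "?w e \<le> w (v, y) / w (v, x) * w (v, x)"
        unfolding we using pos by (intro mult_left_mono le) simp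
      then have "?w e \<le> w (v, y)"
        using pos by simp
      moreover have "w (a, b) \<le> ?w e"
        using pos assms(2) nonneg[OF 1(1)] by (simp add: we field_simps)
      ultimately show ?thesis
        using v_arcs(3) 1(1) by blast
    next
      case False
      then have "?w e = w (a, b)"
        using 1 ab by (simp add: suppressed_weight_old)
      then show ?thesis
        using 1(1) by (metis order_refl)
    qed
  qed (use v_arcs(3) ab in \<open>auto intro!: bexI[of _ "(v, y)"]\<close>)
  then show "\<exists>e'\<in>parcs G. ?w e \<le> w e'" "\<exists>e'\<in>parcs G. w e' \<le> ?w e"
    by auto
qed

end

section \<open>Iterating suppressions\<close>

lemma suppress_commute: "suppress T v x y = suppress T v y x"
  by (auto simp: suppress_def)

lemma suppress_step_DN_LLY:
  assumes "pair_forest T" "suppress_step T T'"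
  shows "pair_forest T' \<and> DN_LLY T' \<le> DN_LLY T"
proof -
  interpret pair_forest T
    by fact
  obtain v x y where v: "out_degree (with_proj T) v = 2" "x \<noteq> y"
    "(v, x) \<in> parcs T" "(v, y) \<in> parcs T" "T' = suppress T v x y"
    using assms(2) unfolding suppress_step_def by blast
  have "out_arcs (with_proj T) v = Pair v ` neighbors T v"
    by (auto simp: neighbors_def out_arcs_def)
  then have "card (neighbors T v) = 2"
    using v(1) by (simp add: out_degree_def card_image inj_on_def)
  moreover have "{x, y} \<subseteq> neighbors T v" "card {x, y} = 2"
    using v by (auto simp: neighbors_def)
  ultimately have N: "neighbors T v = {x, y}"
    using card_subset_eq[of "neighbors T v" "{x, y}"] by simp
  interpret xy: degree_two_vertex T v x y
    by unfold_locales (use N v in auto)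
  interpret yx: degree_two_vertex T v y x
    by unfold_locales (use N v in auto)
  \<comment> \<open>The side behind the lighter of the two edges at \<open>v\<close> is rescaled;
    which one this is depends on \<open>w\<close>.\<close>
  have "\<exists>w'. admissible T' w' \<and> distortion T' w' \<le> distortion T w" if "admissible T w" for w
  proof (cases "w (v, x) \<le> w (v, y)")
    case True
    then show ?thesis
      using xy.admissible_suppressed[OF that] xy.distortion_suppressed_le[OF that] v by blast
  next
    case False
    then show ?thesis
      using yx.admissible_suppressed[OF that] yx.distortion_suppressed_le[OF that] v
        suppress_commute[of T v x y] by force
  qed
  then have "(INF w\<in>{w. admissible T' w}. distortion T' w) \<le> (INF w\<in>{w. admissible T w}. distortion T w)"
    by (intro INF_mono) auto
  \<comment> \<open>Two vertices survive, so the convention for a single vertex in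
    \<open>DN_LLY\<close> does not interfere.\<close>
  moreover have "{x, y} \<subseteq> pverts T'" "{x, y} \<subseteq> pverts T"
    using v xy.v_arcs in_arcsD2 by (auto simp: suppress_def)
  then have "card (pverts T) \<noteq> 1" "card (pverts T') \<noteq> 1"
    using v(2) by (auto simp: card_1_singleton_iff)
  ultimately show ?thesis
    using xy.pair_forest_suppress v(5) by (simp add: DN_LLY_def)
qed

theorem theorem1p4:
  fixes T S :: "'a pair_pre_digraph"
  assumes "finite_tree T"
    and "is_two_suppression T S"
  shows "DN_LLY S \<le> DN_LLY T"
proof -
  have "suppress_step\<^sup>*\<^sup>* T S"
    using assms(2) by (simp add: is_two_suppression_def)
  \<comment> \<open>The forest property is carried along because each further step relies on
    it.\<close>
  then have "pair_forest S \<and> DN_LLY S \<le> DN_LLY T"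
  proof induct
    case base
    show ?case
      using pair_forest_finite_tree[OF assms(1)] by simp
  next
    case (step U V)
    then show ?case
      using suppress_step_DN_LLY[of U V] by (meson order_trans)
  qed
  then show ?thesis ..
qed

end
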